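(* Let $n$ be a prime power, $\mathcal{U}=\mathcal{F}=\mathrm{GF}(n)$, and let $s,r,t$ be integers with $s<r\le n$ and $1\le t\le s$. The entropy loss of the Juels–Sudan scheme (described in the context) is at most $$t\log n+\log\binom nr-\log\binom{n-s}{r-s}+2;$$ that is, for every random variable $W$ over the $s$-element subsets of $\mathcal{F}$, $\tilde{\mathbf{H}}_\infty(W\mid\mathsf{SS}(W))\ge\mathbf{H}_\infty(W)-\left(t\log n+\log\binom nr-\log\binom{n-s}{r-s}+2\right)$.
   Context: Logarithms are base 2. Min-entropy: $\mathbf{H}_\infty(A)=-\log\max_a\Pr[A=a]$; average min-entropy: $\tilde{\mathbf{H}}_\infty(A\mid B)=-\log\big(\mathbb{E}_{b\leftarrow B}[\max_a\Pr[A=a\mid B=b]]\big)$. Juels–Sudan scheme. $\mathsf{SS}(w)$ on input a set $w=\{x_1,\dots,x_s\}\subseteq\mathcal{F}$ of size $s$: (1) choose $p$ uniformly at random from the polynomials over $\mathcal{F}$ of degree at most $s-t-1$ (only the zero polynomial if $t=s$), and let $y_i=p(x_i)$ for $i=1,\dots,s$; (2) choose $r-s$ distinct points $x_{s+1},\dots,x_r$ at random from $\mathcal{F}\setminus w$ (uniformly random $(r-s)$-subset); (3) for $i=s+1,\dots,r$, choose $y_i\in\mathcal{F}$ uniformly at random subject to $y_i\ne p(x_i)$; (4) output the set $\{(x_1,y_1),\dots,(x_r,y_r)\}$ in lexicographic order of the $x_i$. *)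

theory Defs
  imports
    "HOL-Probability.Probability"
    "HOL-Computational_Algebra.Polynomial"
    "HOL-Number_Theory.Prime_Powers"
begin

text \<open>
  Entropies of discrete random variables, given by their (joint) distribution. The point
  probabilities of a discrete distribution are summable, so each supremum below is attained and
  is the maximum.
\<close>

definition min_entropy :: "'a pmf \<Rightarrow> real" where
  "min_entropy A = - log 2 (SUP a. pmf A a)"

definition avg_min_entropy :: "('a \<times> 'b) pmf \<Rightarrow> real" where
  "avg_min_entropy AB =
     - log 2 (measure_pmf.expectation (map_pmf snd AB)
                (\<lambda>b. SUP a. \<P>(z in measure_pmf AB. fst z = a \<bar> snd z = b)))"

definition joint_with :: "'a pmf \<Rightarrow> ('a \<Rightarrow> 'b pmf) \<Rightarrow> ('a \<times> 'b) pmf" where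
  "joint_with W K = do { w \<leftarrow> W; v \<leftarrow> K w; return_pmf (w, v) }"

text \<open>
  The case distinction is needed because natural number subtraction truncates: for \<open>t = s\<close> the
  degree bound is \<open>-1\<close>, not \<open>0\<close>.
\<close>

definition JS_polys :: "nat \<Rightarrow> nat \<Rightarrow> 'a::field poly set" where
  "JS_polys s t = (if t = s then {0} else {p. degree p \<le> s - t - 1})"

text \<open>
  The class \<open>linorder\<close> only supplies some linear order on the field elements, used to list the
  output; it is unrelated to the field operations.
  The values at the chaff points \<open>X\<close> are drawn independently; the second argument of
  \<^const>\<open>Pi_pmf\<close> is the value outside \<open>X\<close>, which is never read.
\<close>

definition juels_sudan ::
    "nat \<Rightarrow> nat \<Rightarrow> nat \<Rightarrow> 'a::{finite,field,linorder} set \<Rightarrow> ('a \<times> 'a) list pmf" where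
  "juels_sudan s r t w = do {
     p \<leftarrow> pmf_of_set (JS_polys s t);
     X \<leftarrow> pmf_of_set {X. X \<subseteq> UNIV - w \<and> card X = r - s};
     y \<leftarrow> Pi_pmf X 0 (\<lambda>x. pmf_of_set (UNIV - {poly p x}));
     return_pmf (map (\<lambda>x. (x, if x \<in> w then poly p x else y x)) (sorted_list_of_set (w \<union> X)))
   }"

end

theory Submission
  imports Defs
begin

text \<open>
  Given \<open>w\<close>, every output of the scheme reveals the whole randomness \<open>(p, X, y)\<close>: the \<open>s\<close> points
  over \<open>w\<close> determine \<open>p\<close>, whose degree is less than \<open>s\<close>. Hence each output has conditional
  probability at most \<open>q = 1 / (n ^ (s-t) * (n-s choose r-s) * (n-1) ^ (r-s))\<close>. Bounding the sum of
  \<open>max\<^sub>w Pr[W = w, V = v]\<close> over the at most \<open>(n choose r) * n ^ r\<close> outputs \<open>v\<close> by the number of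
  outputs times \<open>q * max\<^sub>w Pr[W = w]\<close> gives the claim, since
  \<open>(n / (n-1)) ^ (r-s) \<le> (1 + 1 / (n-1)) ^ (n-1) \<le> e < 4\<close>.
\<close>

section \<open>Pointwise bounds and average min-entropy\<close>

text \<open>By \<open>unique\<close>, at most one intermediate value \<open>x\<close> can lead to
  \<open>v\<close>, so the sum defining the bind collapses to a single product. Applied to nested
  draws, this multiplies the bounds of the stages.\<close>

lemma pmf_bind_le:
  assumes "0 \<le> a" and a: "\<And>x. pmf A x \<le> a"
    and "0 \<le> b" and b: "\<And>x. x \<in> set_pmf A \<Longrightarrow> pmf (f x) v \<le> b"
    and unique: "\<And>x y. \<lbrakk>x \<in> set_pmf A; y \<in> set_pmf A; v \<in> set_pmf (f x); v \<in> set_pmf (f y)\<rbrakk> \<Longrightarrow> x = y"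
  shows "pmf (bind_pmf A f) v \<le> a * b"
proof (cases "\<exists>x\<in>set_pmf A. v \<in> set_pmf (f x)")
  case True
  then obtain x where x: "x \<in> set_pmf A" "v \<in> set_pmf (f x)" by blast
  have "pmf (bind_pmf A f) v = (\<Sum>z\<in>{x}. pmf (f z) v * pmf A z)"
    unfolding pmf_bind
    by (rule integral_measure_pmf_real) (use x unique in \<open>auto simp: set_pmf_iff\<close>)
  also have "\<dots> = pmf A x * pmf (f x) v" by simp
  also have "\<dots> \<le> a * b" using a b[OF x(1)] \<open>0 \<le> a\<close> by (intro mult_mono) auto
  finally show ?thesis .
next
  case False
  then have "v \<notin> set_pmf (bind_pmf A f)" by auto
  then have "pmf (bind_pmf A f) v = 0" by (simp only: set_pmf_iff not_not)
  then show ?thesis using \<open>0 \<le> a\<close> \<open>0 \<le> b\<close> by simp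
qed

lemma pmf_joint_with: "pmf (joint_with W K) (w, v) = pmf W w * pmf (K w) v"
proof -
  have "pmf (joint_with W K) (w, v) = (\<integral>w'. pmf (map_pmf (Pair w') (K w')) (w, v) \<partial>W)"
    by (simp add: joint_with_def pmf_bind map_pmf_def)
  also have "\<dots> = (\<Sum>w'\<in>{w}. pmf (map_pmf (Pair w') (K w')) (w, v) * pmf W w')"
    by (rule integral_measure_pmf_real) (auto simp: pmf_eq_0_set_pmf)
  also have "\<dots> = pmf W w * pmf (K w) v"
    by (simp add: pmf_map_inj' inj_on_def)
  finally show ?thesis .
qed

text \<open>Averaging over \<open>b\<close> cancels the denominator of the conditional probability,
  so the expectation is the sum over \<open>b\<close> of the largest joint probability. Each of the
  at most \<open>card S\<close> nonzero terms is bounded by \<open>c\<close>.\<close>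

lemma avg_min_entropy_ge:
  fixes AB :: "('a::finite \<times> 'b) pmf"
  assumes "finite S" and supp: "snd ` set_pmf AB \<subseteq> S" and c: "\<And>a b. pmf AB (a, b) \<le> c"
  shows "- log 2 (real (card S) * c) \<le> avg_min_entropy AB"
proof -
  let ?B = "map_pmf snd AB"
  let ?g = "\<lambda>b. SUP a. \<P>(z in measure_pmf AB. fst z = a \<bar> snd z = b)"
  let ?E = "measure_pmf.expectation ?B ?g"
  have fin: "finite (range f)" for f :: "'a \<Rightarrow> real" by simp
  \<comment> \<open>Outside the support of \<open>?B\<close> both sides are 0, as division by zero
    gives 0.\<close>
  have cond: "\<P>(z in measure_pmf AB. fst z = a \<bar> snd z = b) = pmf AB (a, b) / pmf ?B b" for a b
  proof -
    have "{z. fst z = a \<and> snd z = b} = {(a, b)}" by auto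
    moreover have "measure_pmf.prob AB {z. snd z = b} = pmf ?B b"
      by (simp add: pmf_map vimage_def)
    ultimately show ?thesis by (simp add: cond_prob_def measure_pmf_single)
  qed
  have g_le: "?g b * pmf ?B b \<le> c" if "b \<in> set_pmf ?B" for b
  proof -
    have pos: "pmf ?B b > 0" using that by (rule pmf_positive)
    have "?g b \<le> c / pmf ?B b"
      unfolding cond using c by (intro cSUP_least divide_right_mono) auto
    then show ?thesis using pos by (simp add: field_simps)
  qed
  have g_nonneg: "0 \<le> ?g b" for b
    unfolding cond by (rule cSUP_upper2[where x = undefined]) (auto intro: bdd_above_finite)
  have c0: "0 \<le> c" using c[of undefined undefined] pmf_nonneg[of AB] by (rule order_trans[rotated])
  have E: "?E = (\<Sum>b\<in>S. ?g b * pmf ?B b)"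
    by (rule integral_measure_pmf_real) (use assms in auto)
  have "(\<Sum>b\<in>S. ?g b * pmf ?B b) \<le> (\<Sum>b\<in>S. c)"
  proof (rule sum_mono)
    show "?g b * pmf ?B b \<le> c" for b
      using g_le[of b] c0 by (cases "b \<in> set_pmf ?B") (auto simp: set_pmf_iff simp del: set_map_pmf)
  qed
  then have le: "?E \<le> real (card S) * c" using E by simp
  \<comment> \<open>A point of the support makes \<open>?E\<close> strictly positive, which
    monotonicity of \<open>log\<close> requires.\<close>
  obtain a b where ab: "(a, b) \<in> set_pmf AB"
    using set_pmf_not_empty[of AB] by (metis all_not_in_conv surj_pair)
  then have b: "b \<in> set_pmf ?B" by force
  have "0 < pmf AB (a, b) / pmf ?B b" using ab b by (intro divide_pos_pos pmf_positive)
  also have "\<dots> \<le> ?g b"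
    unfolding cond by (rule cSUP_upper) (auto intro: bdd_above_finite)
  finally have "0 < ?g b * pmf ?B b" using b by (intro mult_pos_pos pmf_positive)
  then have "0 < ?E"
    unfolding E using \<open>finite S\<close> supp b g_nonneg by (intro sum_pos2[of S b]) auto
  then show ?thesis unfolding avg_min_entropy_def using le by simp
qed

section \<open>Counting and interpolating polynomials\<close>

text \<open>Reduces counting polynomials to counting functions on \<open>{..d}\<close>; the default
  0 encodes the vanishing of the higher coefficients.\<close>

lemma bij_betw_coeff_degree_le:
  "bij_betw coeff {p :: 'a::zero poly. degree p \<le> d} (PiE_dflt {..d} 0 (\<lambda>_. UNIV))"
proof (rule bij_betwI')
  fix f :: "nat \<Rightarrow> 'a" assume "f \<in> PiE_dflt {..d} 0 (\<lambda>_. UNIV)"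
  then have z: "\<And>i. i > d \<Longrightarrow> f i = 0" by (auto simp: PiE_dflt_def)
  then have "coeff (Abs_poly f) = f" by (intro ext coeff_Abs_poly) auto
  moreover from this have "degree (Abs_poly f) \<le> d" using z by (intro degree_le) auto
  ultimately show "\<exists>p\<in>{p. degree p \<le> d}. f = coeff p" by (metis mem_Collect_eq)
qed (auto simp: PiE_dflt_def coeff_eq_0 coeff_inject)

lemma card_degree_le: "card {p :: 'a::{finite,zero} poly. degree p \<le> d} = CARD('a) ^ Suc d"
  by (subst bij_betw_same_card[OF bij_betw_coeff_degree_le], subst card_PiE_dflt) simp_all

lemma finite_JS_polys [simp]: "finite (JS_polys s t :: 'a::{finite,field} poly set)"
proof -
  have "finite {p :: 'a poly. degree p \<le> s - t - 1}" by (rule card_ge_0_finite) (simp add: card_degree_le)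
  then show ?thesis by (simp add: JS_polys_def)
qed

lemma JS_polys_nonempty [simp]: "JS_polys s t \<noteq> {}"
  by (auto simp: JS_polys_def intro: exI[of _ 0])

lemma card_JS_polys:
  "t \<le> s \<Longrightarrow> card (JS_polys s t :: 'a::{finite,field} poly set) = CARD('a) ^ (s - t)"
  by (auto simp: JS_polys_def card_degree_le Suc_diff_Suc simp del: power_Suc)

text \<open>For \<open>t < s\<close> the degrees are below \<open>s\<close>, so agreement on
  \<open>s\<close> points forces equality; for \<open>t = s\<close> only the zero polynomial is
  available.\<close>

lemma JS_polys_eqI:
  assumes "p \<in> JS_polys s t" "q \<in> JS_polys s t" "t \<le> s" "card w = s"
    and "\<And>x. x \<in> w \<Longrightarrow> poly p x = poly q x"
  shows "p = q"
proof (cases "t = s")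
  case False
  then show ?thesis using assms by (intro poly_eqI_degree[of w]) (auto simp: JS_polys_def)
qed (use assms in \<open>simp add: JS_polys_def\<close>)

section \<open>Vaults: the possible outputs and their number\<close>

definition vault :: "('a::linorder \<Rightarrow> 'b) \<Rightarrow> 'a set \<Rightarrow> ('a \<times> 'b) list" where
  "vault f A = map (\<lambda>x. (x, f x)) (sorted_list_of_set A)"

text \<open>The entries of a vault form the graph of \<open>f\<close> on \<open>A\<close>, from
  which both the domain and the values can be read off.\<close>

lemma vault_eqD:
  assumes "vault f A = vault g B" "finite A" "finite B"
  shows "A = B" and "\<And>x. x \<in> A \<Longrightarrow> f x = g x"
proof -
  have "(\<lambda>x. (x, f x)) ` A = (\<lambda>x. (x, g x)) ` B"
    using arg_cong[OF assms(1), of set] assms(2,3) by (simp add: vault_def)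
  then show "A = B" and "\<And>x. x \<in> A \<Longrightarrow> f x = g x" by auto
qed

lemma juels_sudan_vault:
  "juels_sudan s r t w = do {
     p \<leftarrow> pmf_of_set (JS_polys s t);
     X \<leftarrow> pmf_of_set {X. X \<subseteq> UNIV - w \<and> card X = r - s};
     y \<leftarrow> Pi_pmf X 0 (\<lambda>x. pmf_of_set (UNIV - {poly p x}));
     return_pmf (vault (\<lambda>x. if x \<in> w then poly p x else y x) (w \<union> X))
   }"
  by (simp add: juels_sudan_def vault_def)

text \<open>Extensional functions are used so that values outside \<open>A\<close>, which a vault
  does not show, do not inflate the count.\<close>

definition vaults :: "nat \<Rightarrow> ('a::{finite,linorder} \<times> 'a) list set" where
  "vaults r = (\<lambda>(A, f). vault f A) ` (SIGMA A:{A. card A = r}. A \<rightarrow>\<^sub>E UNIV)"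

lemma vault_in_vaults: "card A = r \<Longrightarrow> vault f A \<in> vaults r"
  unfolding vaults_def
  by (rule image_eqI[of _ _ "(A, restrict f A)"]) (auto simp: vault_def)

lemma finite_vaults: "finite (vaults r)"
  unfolding vaults_def by (intro finite_imageI finite_SigmaI finite_PiE) auto

lemma card_vaults_le:
  "card (vaults r :: ('a::{finite,linorder} \<times> 'a) list set) \<le> (CARD('a) choose r) * CARD('a) ^ r"
proof -
  have "card (vaults r :: ('a \<times> 'a) list set) \<le> card (SIGMA A:{A :: 'a set. card A = r}. A \<rightarrow>\<^sub>E (UNIV :: 'a set))"
    unfolding vaults_def by (intro card_image_le finite_SigmaI finite_PiE) auto
  also have "\<dots> = (\<Sum>A | card (A :: 'a set) = r. CARD('a) ^ r)"
    by (subst card_SigmaI) (auto simp: card_funcsetE finite_PiE)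
  also have "\<dots> = (CARD('a) choose r) * CARD('a) ^ r"
    using n_subsets[of "UNIV :: 'a set" r] by simp
  finally show ?thesis .
qed

text \<open>Each of the independent values is uniform on a set of \<open>CARD('a) - 1\<close>
  elements. Only an inequality holds in general, since a \<open>y\<close> that is nonzero outside
  \<open>X\<close> has probability 0.\<close>

lemma pmf_chaff_values_le:
  fixes p :: "'a::{finite,field} poly"
  shows "pmf (Pi_pmf X 0 (\<lambda>x. pmf_of_set (UNIV - {poly p x}))) y \<le> 1 / real (CARD('a) - 1) ^ card X"
proof -
  have ne: "UNIV - {z :: 'a} \<noteq> {}" for z
    by (metis Diff_eq_empty_iff UNIV_I empty_iff insertE subsetD zero_neq_one)
  have "pmf (pmf_of_set (UNIV - {z})) u \<le> 1 / real (CARD('a) - 1)" for z u :: 'a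
    unfolding pmf_of_set[OF ne finite] by (simp add: indicator_def card_Diff_singleton)
  then have "(\<Prod>x\<in>X. pmf (pmf_of_set (UNIV - {poly p x})) (y x)) \<le> (\<Prod>x\<in>X. 1 / real (CARD('a) - 1))"
    by (intro prod_mono conjI pmf_nonneg)
  then show ?thesis by (auto simp: pmf_Pi power_one_over)
qed

section \<open>The output distribution for a fixed secret set\<close>

context
  fixes w :: "'a::{finite,field,linorder} set" and s r t :: nat
  assumes w: "card w = s" and sr: "s \<le> r" "r \<le> CARD('a)"
begin

lemma card_chaff_sets: "card {X. X \<subseteq> UNIV - w \<and> card X = r - s} = (CARD('a) - s) choose (r - s)"
  using w by (subst n_subsets) (simp_all add: card_Diff_subset)

lemma chaff_sets_nonempty: "{X. X \<subseteq> UNIV - w \<and> card X = r - s} \<noteq> {}"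
proof -
  have "card {X. X \<subseteq> UNIV - w \<and> card X = r - s} > 0"
    unfolding card_chaff_sets using sr by simp
  then show ?thesis by (metis card.empty less_irrefl)
qed

lemma set_pmf_chaff:
  "set_pmf (pmf_of_set {X. X \<subseteq> UNIV - w \<and> card X = r - s}) = {X. X \<subseteq> UNIV - w \<and> card X = r - s}"
  by (rule set_pmf_of_set[OF chaff_sets_nonempty finite])

lemma set_pmf_juels_sudan_subset: "set_pmf (juels_sudan s r t w) \<subseteq> vaults r"
proof -
  have "card (w \<union> X) = r" if "X \<subseteq> UNIV - w" "card X = r - s" for X
    using that w sr by (subst card_Un_disjoint) auto
  then show ?thesis
    by (auto simp: juels_sudan_vault set_pmf_chaff intro!: vault_in_vaults)
qed

lemma pmf_juels_sudan_le:
  assumes ts: "t \<le> s"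
  shows "pmf (juels_sudan s r t w) v \<le>
    1 / (real CARD('a) ^ (s - t) * real ((CARD('a) - s) choose (r - s)) * real (CARD('a) - 1) ^ (r - s))"
proof -
  \<comment> \<open>One factor for each draw, of \<open>p\<close>, \<open>X\<close> and
    \<open>y\<close>; the final 1 bounds the closing \<open>return_pmf\<close>.\<close>
  have "pmf (juels_sudan s r t w) v \<le>
    1 / real (CARD('a) ^ (s - t)) *
    (1 / real ((CARD('a) - s) choose (r - s)) * (1 / real (CARD('a) - 1) ^ (r - s) * 1))"
    unfolding juels_sudan_vault
  proof (intro pmf_bind_le, goal_cases)
    case (2 p)
    then show ?case using ts by (simp add: card_JS_polys indicator_def)
  next
    case (5 p X)
    show ?case
      unfolding pmf_of_set[OF chaff_sets_nonempty finite] card_chaff_sets by (simp add: indicator_def)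
  next
    case (8 p X y)
    then show ?case using pmf_chaff_values_le[of X p y] by (simp add: set_pmf_chaff)
  next
    \<comment> \<open>Uniqueness of \<open>y\<close>: the vault shows its values on
      \<open>X\<close>, and elsewhere it is the default 0.\<close>
    case (11 p X y y')
    then have X: "X \<subseteq> UNIV - w"
      and eq: "vault (\<lambda>x. if x \<in> w then poly p x else y x) (w \<union> X) =
        vault (\<lambda>x. if x \<in> w then poly p x else y' x) (w \<union> X)"
      and outside: "y \<in> {f. \<forall>x. x \<notin> X \<longrightarrow> f x = 0}" "y' \<in> {f. \<forall>x. x \<notin> X \<longrightarrow> f x = 0}"
      using set_Pi_pmf_subset[of X 0] by (auto simp: set_pmf_chaff)
    have "y x = y' x" for x
      using vault_eqD(2)[OF eq, of x] X outside by (cases "x \<in> X") auto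
    then show ?case by blast
  next
    \<comment> \<open>Uniqueness of \<open>X\<close>: it is the domain of the vault with the
      disjoint set \<open>w\<close> removed.\<close>
    case (12 p X X')
    then have XX: "X \<subseteq> UNIV - w" "X' \<subseteq> UNIV - w" by (auto simp: set_pmf_chaff)
    from 12 obtain y y' where
      eq: "vault (\<lambda>x. if x \<in> w then poly p x else y x) (w \<union> X) =
        vault (\<lambda>x. if x \<in> w then poly p x else y' x) (w \<union> X')"
      by auto
    have "w \<union> X = w \<union> X'" by (rule vault_eqD(1)[OF eq]) auto
    then show ?case using XX by blast
  next
    \<comment> \<open>Uniqueness of \<open>p\<close>: the vault shows its values at the
      \<open>s\<close> points of \<open>w\<close>, whatever the chaff.\<close>
    case (13 p p')
    then obtain X y X' y' where
      pp: "p \<in> JS_polys s t" "p' \<in> JS_polys s t" and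
      eq: "vault (\<lambda>x. if x \<in> w then poly p x else y x) (w \<union> X) =
        vault (\<lambda>x. if x \<in> w then poly p' x else y' x) (w \<union> X')"
      by (auto simp del: set_Pi_pmf)
    show ?case
      using pp ts w
    proof (rule JS_polys_eqI)
      show "poly p x = poly p' x" if "x \<in> w" for x
        using vault_eqD(2)[OF eq, of x] that by simp
    qed
  qed (simp_all add: pmf_le_1)
  then show ?thesis by simp
qed

end

section \<open>Assembling the entropy bound\<close>

text \<open>The ratio compares the \<open>n\<close> values allowed per chaff point when counting
  vaults with the \<open>n - 1\<close> values that are actually drawn. The bound 4 becomes the
  additive 2 in the entropy loss.\<close>

lemma power_ratio_le_4:
  assumes "2 \<le> n" "k \<le> n - 1"
  shows "(real n / real (n - 1)) ^ k \<le> 4"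
proof -
  have "(real n / real (n - 1)) ^ k \<le> (real n / real (n - 1)) ^ (n - 1)"
    using assms by (intro power_increasing) auto
  also have "\<dots> = (1 + 1 / real (n - 1)) ^ (n - 1)"
    using assms by (intro arg_cong[of _ _ "\<lambda>x. x ^ (n - 1)"]) (simp add: field_simps)
  also have "\<dots> \<le> exp 1"
    using assms by (intro exp_ge_one_plus_x_over_n_power_n) auto
  also have "\<dots> \<le> 4" using exp_le by simp
  finally show ?thesis .
qed

theorem lemmaD1:
  fixes W :: "'a::{finite,field,linorder} set pmf" and n s r t :: nat
  assumes "primepow n" and "CARD('a) = n"
    and "s < r" and "r \<le> n" and "1 \<le> t" and "t \<le> s"
    and "set_pmf W \<subseteq> {w. card w = s}"
  shows "avg_min_entropy (joint_with W (juels_sudan s r t)) \<ge>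
    min_entropy W -
      (real t * log 2 (real n) + log 2 (real (n choose r))
        - log 2 (real ((n - s) choose (r - s))) + 2)"
proof -
  \<comment> \<open>\<open>M\<close> is 2 to the power \<open>- min_entropy W\<close>, and
    \<open>q\<close> bounds the probability of any output given a secret set.\<close>
  define M where "M = (SUP w. pmf W w)"
  define q where
    "q = 1 / (real n ^ (s - t) * real ((n - s) choose (r - s)) * real (n - 1) ^ (r - s))"
  have n2: "2 \<le> n" using primepow_gt_Suc_0[OF assms(1)] by simp
  have M: "pmf W w \<le> M" for w
    unfolding M_def by (rule cSUP_upper) (auto intro: bdd_above_finite)
  obtain w0 where "w0 \<in> set_pmf W" using set_pmf_not_empty[of W] by blast
  then have M0: "0 < M" using M[of w0] pmf_positive[of w0 W] by simp
  have q0: "0 < q" unfolding q_def using n2 assms by simp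
  let ?J = "joint_with W (juels_sudan s r t)"
  have J_le: "pmf ?J (w, v) \<le> M * q" for w v
  proof (cases "w \<in> set_pmf W")
    case True
    then have "pmf (juels_sudan s r t w) v \<le> q"
      unfolding q_def using assms pmf_juels_sudan_le[of w s r t v] by auto
    then show ?thesis unfolding pmf_joint_with using M M0 by (intro mult_mono) auto
  next
    case False
    then show ?thesis using M0 q0 by (simp add: pmf_joint_with set_pmf_iff)
  qed
  have supp: "snd ` set_pmf ?J \<subseteq> vaults r"
  proof -
    have "set_pmf (juels_sudan s r t w) \<subseteq> vaults r" if "w \<in> set_pmf W" for w
      using that assms by (intro set_pmf_juels_sudan_subset) auto
    then show ?thesis by (force simp: joint_with_def)
  qed
  have entropy: "- log 2 (real (card (vaults r :: ('a \<times> 'a) list set)) * (M * q)) \<le> avg_min_entropy ?J"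
    by (rule avg_min_entropy_ge[OF finite_vaults supp J_le])
  have "vaults r \<noteq> ({} :: ('a \<times> 'a) list set)" using supp set_pmf_not_empty[of ?J] by auto
  then have card0: "0 < card (vaults r :: ('a \<times> 'a) list set)" by (simp add: card_gt_0_iff finite_vaults)
  let ?C = "real ((n - s) choose (r - s))"
  have C0: "0 < ?C" using assms by simp
  have R0: "0 < real (n choose r)" using assms by simp
  have "real (card (vaults r :: ('a \<times> 'a) list set)) * q \<le> real ((n choose r) * n ^ r) * q"
    using card_vaults_le[of r, where 'a = 'a] q0 assms by (intro mult_right_mono of_nat_mono) auto
  also have "\<dots> = real n ^ t * real (n choose r) / ?C * (real n / real (n - 1)) ^ (r - s)"
  proof -
    \<comment> \<open>The first factor cancels against the number of polynomials in
      \<open>q\<close>, the second is the loss \<open>n ^ t\<close>, and the third forms the ratio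
      with \<open>(n - 1) ^ (r - s)\<close>.\<close>
    have "n ^ r = n ^ (s - t) * n ^ t * n ^ (r - s)"
      using assms by (simp flip: power_add)
    then show ?thesis unfolding q_def using n2 by (simp add: power_divide field_simps)
  qed
  also have "\<dots> \<le> real n ^ t * real (n choose r) / ?C * 4"
    \<comment> \<open>From \<open>1 \<le> t\<close> and \<open>t \<le> s\<close> follows
      \<open>1 \<le> s\<close>, hence \<open>r - s \<le> n - 1\<close>.\<close>
    using assms n2 by (intro mult_left_mono power_ratio_le_4) auto
  finally have "M * (real (card (vaults r :: ('a \<times> 'a) list set)) * q)
      \<le> M * (real n ^ t * real (n choose r) / ?C * 4)"
    using M0 by (intro mult_left_mono) auto
  then have "real (card (vaults r :: ('a \<times> 'a) list set)) * (M * q)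
      \<le> M * (real n ^ t * real (n choose r) / ?C * 4)"
    by (simp only: mult.left_commute)
  then have "log 2 (real (card (vaults r :: ('a \<times> 'a) list set)) * (M * q))
      \<le> log 2 (M * (real n ^ t * real (n choose r) / ?C * 4))"
    using card0 M0 q0 C0 R0 n2 by (subst log_le_cancel_iff) simp_all
  also have "\<dots> = log 2 M + (real t * log 2 (real n) + log 2 (real (n choose r)) - log 2 ?C + 2)"
  proof -
    have "log 2 4 = (2::real)" using log_pow_cancel[of 2 2] by simp
    then show ?thesis using M0 C0 R0 n2 by (simp add: log_mult log_divide log_nat_power)
  qed
  finally show ?thesis using entropy unfolding min_entropy_def M_def by linarith
qed

end
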